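(* Let $f:\mathbb{R}^d\to\mathbb{R}$ be $L$-smooth ($L>0$) and bounded below with $f^*:=\inf_{x\in\mathbb{R}^d} f(x)>-\infty$, and suppose the stochastic gradient oracle is unbiased and satisfies the $(\rho,\sigma)$-strong growth condition, with $\rho\ge0$ and $\sigma\ge0$. Let $(x_t)_{t\ge1}$ be the iterates of stochastic dual averaging (SDA) with the adaptive step sizes $$\eta_t=\frac{\eta}{\sqrt{\gamma+\sum_{i=1}^t\|g_i\|^2}},\qquad t\ge1,$$ where $\eta>0$ and $\gamma\ge0$ are constants and $g_i$ is the stochastic gradient at $x_i$. Let $x^*$ be a global minimizer of $f$ and, for an integer $T\ge1$, let $$B_T:=\max_{t\le T}\left\{\|x_t-x^*\|\,\|x_t\|+\frac12\|x_t-x^*\|^2+\|x_t\|^2\right\}.$$ Then $$\sum_{t=1}^T\mathbb{E}\left[\|\nabla f(x_t)\|^2\right]\le 2\sqrt2\,L\sigma\left(\mathbb{E}\left[\left(\frac{B_T}{\eta}+2\eta\right)^2\right]\right)^{1/2}\sqrt T+2\sqrt2\,L^2(\sqrt2+\rho)\,\mathbb{E}\left[\left(\frac{B_T}{\eta}+2\eta\right)^2\right]+\frac\gamma2+\frac{2\,(f(0)-f^* )}{\eta}.$$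
   Context: $\|\cdot\|$ is the Euclidean norm on $\mathbb{R}^d$. $L$-smooth: $f$ is differentiable and $f(y)\le f(x)+\langle\nabla f(x),y-x\rangle+\frac L2\|y-x\|^2$ for all $x,y\in\mathbb{R}^d$. (As usual, in the paper smoothness is also used in the form that $\nabla f$ is $L$-Lipschitz.) Stochastic gradient oracle: a query at $x\in\mathbb{R}^d$ returns a random vector $\widehat\nabla f(x)\in\mathbb{R}^d$; different queries use independent randomness. Unbiased: $\mathbb{E}[\widehat\nabla f(x)\mid x]=\nabla f(x)$ for all $x$. $(\rho,\sigma)$-strong growth condition: $\mathbb{E}\left[\|\widehat\nabla f(x)-\nabla f(x)\|^2\right]\le\rho\|\nabla f(x)\|^2+\sigma^2$ for all $x\in\mathbb{R}^d$. Along the iterates these hold conditionally on the past: with $g_t:=\widehat\nabla f(x_t)$, $\xi_t:=g_t-\nabla f(x_t)$ and $\mathcal{F}_t:=\sigma(\xi_1,\dots,\xi_{t-1})$ (so $x_t$ is $\mathcal{F}_t$-measurable), $\mathbb{E}[\xi_t\mid\mathcal{F}_t]=0$ and $\mathbb{E}[\|\xi_t\|^2\mid\mathcal{F}_t]\le\rho\|\nabla f(x_t)\|^2+\sigma^2$. SDA with step sizes $(\eta_t)_{t\ge1}$: $x_1=0$ and $x_{t+1}=-\eta_t\sum_{i=1}^t g_i$ for $t\ge1$, where $g_i=\widehat\nabla f(x_i)$. Here $\eta_t$ may depend on $g_1,\dots,g_t$. If $\gamma=0$, division by zero is avoided by not updating the iterate at steps where the stochastic gradient is zero. *)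

theory Defs
  imports "HOL-Probability.Probability"
begin

section \<open>Smoothness\<close>

definition gradient :: "('a::euclidean_space \<Rightarrow> real) \<Rightarrow> 'a \<Rightarrow> 'a" where
  "gradient f x = (THE D. GDERIV f x :> D)"

definition L_smooth :: "real \<Rightarrow> ('a::euclidean_space \<Rightarrow> real) \<Rightarrow> bool" where
  "L_smooth L f \<longleftrightarrow>
     (\<forall>x. f differentiable (at x)) \<and>
     (\<forall>x y. f y \<le> f x + inner (gradient f x) (y - x) + L / 2 * (norm (y - x))\<^sup>2)"

section \<open>Stochastic gradient oracles\<close>

text \<open>
  A \<open>grad_oracle\<close> is a family of random vectors on a probability space \<open>M\<close>: \<open>G t x\<close> is the answer that
  the \<open>t\<close>-th query (\<open>t \<ge> 1\<close>) returns if it is made at the point \<open>x\<close>.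
\<close>

type_synonym ('w, 'a) grad_oracle = "nat \<Rightarrow> 'a \<Rightarrow> 'w \<Rightarrow> 'a"

definition unbiased_oracle ::
  "'w measure \<Rightarrow> ('a::euclidean_space \<Rightarrow> real) \<Rightarrow> ('w, 'a) grad_oracle \<Rightarrow> bool" where
  "unbiased_oracle M f G \<longleftrightarrow>
     (\<forall>t\<ge>1. \<forall>x. integrable M (G t x) \<and> (\<integral>\<omega>. G t x \<omega> \<partial>M) = gradient f x)"

definition strong_growth_oracle ::
  "'w measure \<Rightarrow> ('a::euclidean_space \<Rightarrow> real) \<Rightarrow> real \<Rightarrow> real \<Rightarrow> ('w, 'a) grad_oracle \<Rightarrow> bool" where
  "strong_growth_oracle M f \<rho> \<sigma> G \<longleftrightarrow>
     (\<forall>t\<ge>1. \<forall>x. G t x \<in> borel_measurable M \<and>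
        (\<integral>\<^sup>+\<omega>. ennreal ((norm (G t x \<omega> - gradient f x))\<^sup>2) \<partial>M)
          \<le> ennreal (\<rho> * (norm (gradient f x))\<^sup>2 + \<sigma>\<^sup>2))"

text \<open>
  Along the iterates both properties are required conditionally on the past; this is how the
  independence of the randomness of different queries enters.
\<close>

definition noise ::
  "('a::euclidean_space \<Rightarrow> real) \<Rightarrow> (nat \<Rightarrow> 'w \<Rightarrow> 'a) \<Rightarrow> (nat \<Rightarrow> 'w \<Rightarrow> 'a) \<Rightarrow> nat \<Rightarrow> 'w \<Rightarrow> 'a" where
  "noise f x g t \<omega> = g t \<omega> - gradient f (x t \<omega>)"

definition past :: "'w measure \<Rightarrow> (nat \<Rightarrow> 'w \<Rightarrow> 'a::euclidean_space) \<Rightarrow> nat \<Rightarrow> 'w measure" where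
  "past M \<xi> t =
     sigma (space M) (\<Union>i\<in>{1..<t}. {\<xi> i -` A \<inter> space M | A. A \<in> sets borel})"

text \<open>
  The library's conditional expectation is real-valued, so \<open>E[\<xi>\<^sub>t | F\<^sub>t] = 0\<close> is stated for each
  coordinate.  It is not required that \<open>\<xi>\<^sub>t\<close> be integrable: \<^const>\<open>real_cond_exp\<close> is the difference
  of the conditional expectations of the positive and the negative part, and
  \<open>strong_growth_along\<close> makes both of them almost surely finite.
\<close>

definition unbiased_along ::
  "'w measure \<Rightarrow> ('a::euclidean_space \<Rightarrow> real) \<Rightarrow> (nat \<Rightarrow> 'w \<Rightarrow> 'a) \<Rightarrow> (nat \<Rightarrow> 'w \<Rightarrow> 'a) \<Rightarrow> bool" where
  "unbiased_along M f x g \<longleftrightarrow>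
     (\<forall>t\<ge>1. \<forall>b\<in>Basis. AE \<omega> in M.
        real_cond_exp M (past M (noise f x g) t) (\<lambda>\<omega>. inner (noise f x g t \<omega>) b) \<omega> = 0)"

definition strong_growth_along ::
  "'w measure \<Rightarrow> ('a::euclidean_space \<Rightarrow> real) \<Rightarrow> real \<Rightarrow> real
     \<Rightarrow> (nat \<Rightarrow> 'w \<Rightarrow> 'a) \<Rightarrow> (nat \<Rightarrow> 'w \<Rightarrow> 'a) \<Rightarrow> bool" where
  "strong_growth_along M f \<rho> \<sigma> x g \<longleftrightarrow>
     (\<forall>t\<ge>1. AE \<omega> in M.
        nn_cond_exp M (past M (noise f x g) t) (\<lambda>\<omega>. ennreal ((norm (noise f x g t \<omega>))\<^sup>2)) \<omega>
          \<le> ennreal (\<rho> * (norm (gradient f (x t \<omega>)))\<^sup>2 + \<sigma>\<^sup>2))"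

section \<open>Stochastic dual averaging\<close>

definition adaptive_step ::
  "real \<Rightarrow> real \<Rightarrow> (nat \<Rightarrow> 'w \<Rightarrow> 'a::euclidean_space) \<Rightarrow> nat \<Rightarrow> 'w \<Rightarrow> real" where
  "adaptive_step \<eta> \<gamma> g t \<omega> = \<eta> / sqrt (\<gamma> + (\<Sum>i=1..t. (norm (g i \<omega>))\<^sup>2))"

text \<open>
  \<open>x t\<close> and \<open>g t\<close> (\<open>t \<ge> 1\<close>; index \<open>0\<close> is unused) are the iterates and the stochastic gradients of
  a run of SDA with queries to \<open>G\<close>.  The first case of the update is the convention for \<open>\<gamma> = 0\<close>.
\<close>

definition adaptive_sda_run ::
  "'w measure \<Rightarrow> ('w, 'a::euclidean_space) grad_oracle \<Rightarrow> real \<Rightarrow> real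
     \<Rightarrow> (nat \<Rightarrow> 'w \<Rightarrow> 'a) \<Rightarrow> (nat \<Rightarrow> 'w \<Rightarrow> 'a) \<Rightarrow> bool" where
  "adaptive_sda_run M G \<eta> \<gamma> x g \<longleftrightarrow>
     (\<forall>t\<ge>1. g t \<in> borel_measurable M) \<and>
     (\<forall>\<omega>\<in>space M.
        x 1 \<omega> = 0 \<and>
        (\<forall>t\<ge>1. g t \<omega> = G t (x t \<omega>) \<omega>) \<and>
        (\<forall>t\<ge>1. x (t + 1) \<omega> =
           (if \<gamma> = 0 \<and> g t \<omega> = 0 then x t \<omega>
            else - adaptive_step \<eta> \<gamma> g t \<omega> *\<^sub>R (\<Sum>i=1..t. g i \<omega>))))"

definition B_max ::
  "'a::euclidean_space \<Rightarrow> (nat \<Rightarrow> 'w \<Rightarrow> 'a) \<Rightarrow> nat \<Rightarrow> 'w \<Rightarrow> real" where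
  "B_max xs x T \<omega> =
     Max ((\<lambda>t. norm (x t \<omega> - xs) * norm (x t \<omega>) + 1 / 2 * (norm (x t \<omega> - xs))\<^sup>2
                + (norm (x t \<omega>))\<^sup>2) ` {1..T})"

section \<open>Square root of an extended expectation\<close>

definition ennreal_sqrt :: "ennreal \<Rightarrow> ennreal" where
  "ennreal_sqrt r = (if r = \<top> then \<top> else ennreal (sqrt (enn2real r)))"

end

theory Submission
  imports Defs
begin

text \<open>
  Put \<open>A\<^sub>t = \<eta> / \<eta>\<^sub>t\<close>.  Then \<open>\<eta> g\<^sub>t = A\<^sub>t\<^sub>-\<^sub>1 x\<^sub>t - A\<^sub>t x\<^sub>t\<^sub>+\<^sub>1\<close>, so the descent inequality weighted by \<open>A\<^sub>t\<close>
  telescopes up to terms proportional to the increments of \<open>A\<close>.  At a point \<open>x\<close> at distance \<open>r\<close> from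
  \<open>x\<^sup>*\<close> the gap \<open>f x - f x\<^sup>*\<close> is at most \<open>L r\<^sup>2 / 2\<close> and the gradient has norm at most \<open>L r\<close>, both by the
  descent inequality alone; hence pathwise
  \<open>\<Sum>\<^sub>t \<langle>\<nabla>f x\<^sub>t, g\<^sub>t\<rangle> \<le> L A\<^sub>T W\<close> with \<open>W = B\<^sub>T / \<eta> + 2 \<eta>\<close>; the initial gap is absorbed by \<open>B\<^sub>T\<close>.  If \<open>E[W\<^sup>2]\<close> is
  finite, then the gradients and the noise are square integrable, the noise is orthogonal to the
  gradients, and Cauchy-Schwarz yields a quadratic inequality for \<open>\<Sum>\<^sub>t E[\<parallel>\<nabla>f x\<^sub>t\<parallel>\<^sup>2]\<close>.
\<close>

section \<open>Smooth functions\<close>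

lemma GDERIV_unique:
  assumes "GDERIV f x :> D" and "GDERIV f x :> E"
  shows "D = E"
proof -
  have "(\<lambda>h. inner h D) = (\<lambda>h. inner h E)"
    using assms unfolding gderiv_def by (rule has_derivative_unique)
  then show ?thesis
    by (metis inner_commute vector_eq_rdot)
qed

text \<open>\<open>gradient\<close> is a definite description, so existence and uniqueness are both
  due. Existence is the Riesz representation: the vector with coordinates
  \<open>F b\<close>.\<close>

lemma GDERIV_gradient:
  fixes f :: "'a::euclidean_space \<Rightarrow> real"
  assumes "f differentiable (at x)"
  shows "GDERIV f x :> gradient f x"
proof -
  obtain F where F: "(f has_derivative F) (at x)"
    using assms unfolding differentiable_def by blast
  interpret F: bounded_linear F
    using F by (rule has_derivative_bounded_linear)
  have "F = (\<lambda>h. inner h (\<Sum>b\<in>Basis. F b *\<^sub>R b))"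
  proof
    fix h
    have "F h = F (\<Sum>b\<in>Basis. inner h b *\<^sub>R b)"
      by (simp add: euclidean_representation)
    also have "\<dots> = inner h (\<Sum>b\<in>Basis. F b *\<^sub>R b)"
      by (simp add: F.sum F.scaleR inner_sum_right mult.commute)
    finally show "F h = inner h (\<Sum>b\<in>Basis. F b *\<^sub>R b)" .
  qed
  then have D: "GDERIV f x :> (\<Sum>b\<in>Basis. F b *\<^sub>R b)"
    using F unfolding gderiv_def by simp
  show ?thesis
    unfolding gradient_def by (rule theI[where P = "\<lambda>D. GDERIV f x :> D", OF D GDERIV_unique[OF _ D]])
qed

text \<open>Each coordinate is the pointwise limit of difference quotients with increments 1/(n+1),
  and each quotient is measurable because a differentiable \<open>f\<close> is continuous.\<close>

lemma borel_measurable_gradient: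
  fixes f :: "'a::euclidean_space \<Rightarrow> real"
  assumes diff: "\<And>x. f differentiable (at x)"
  shows "gradient f \<in> borel_measurable borel"
  unfolding borel_measurable_euclidean_space[where f = "gradient f"]
proof
  fix b :: 'a
  have cont: "continuous_on UNIV f"
    using diff by (simp add: continuous_on_eq_continuous_within differentiable_imp_continuous_within)
  then have [measurable]: "f \<in> borel_measurable borel"
    by (rule borel_measurable_continuous_onI)
  show "(\<lambda>x. inner (gradient f x) b) \<in> borel_measurable borel"
  proof (rule borel_measurable_LIMSEQ_real)
    fix x
    have "((\<lambda>s. f (x + s *\<^sub>R b)) has_derivative (\<lambda>s. inner (s *\<^sub>R b) (gradient f x))) (at 0)"
    proof (rule has_derivative_compose[where f = "\<lambda>s. x + s *\<^sub>R b"])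
      show "((\<lambda>s. x + s *\<^sub>R b) has_derivative (\<lambda>s. s *\<^sub>R b)) (at 0)"
        by (auto intro!: derivative_eq_intros)
      show "(f has_derivative (\<lambda>h. inner h (gradient f x))) (at (x + 0 *\<^sub>R b))"
        using GDERIV_gradient[OF diff, of x] by (simp add: gderiv_def)
    qed
    then have "((\<lambda>s. f (x + s *\<^sub>R b)) has_real_derivative inner (gradient f x) b) (at 0)"
      unfolding has_field_derivative_def by (simp add: inner_commute mult.commute[of _ "inner _ _"])
    then have "((\<lambda>s. (f (x + s *\<^sub>R b) - f x) / s) \<longlongrightarrow> inner (gradient f x) b) (at 0)"
      by (simp add: DERIV_def)
    moreover have "filterlim (\<lambda>n. 1 / real (Suc n)) (at 0) sequentially"
      unfolding filterlim_at using LIMSEQ_inverse_real_of_nat by (simp add: inverse_eq_divide)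
    ultimately show "(\<lambda>n. (f (x + (1 / real (Suc n)) *\<^sub>R b) - f x) / (1 / real (Suc n)))
        \<longlonglongrightarrow> inner (gradient f x) b"
      by (rule filterlim_compose)
  qed measurable
qed

lemma L_smooth_descent:
  assumes "L_smooth L f"
  shows "f y \<le> f x + inner (gradient f x) (y - x) + L / 2 * (norm (y - x))\<^sup>2"
  using assms by (simp add: L_smooth_def)

text \<open>A step of length 1/L against the gradient minimizes the quadratic upper model; it lowers
  \<open>f\<close> by at least the squared gradient norm over 2L, yet cannot pass below
  \<open>m\<close>.\<close>

lemma norm_gradient_sq_le:
  assumes "L_smooth L f" and "L > 0" and "\<And>y. m \<le> f y"
  shows "(norm (gradient f x))\<^sup>2 \<le> 2 * L * (f x - m)"
proof -
  let ?D = "gradient f x"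
  have "m \<le> f (x - (1 / L) *\<^sub>R ?D)" by (rule assms)
  also have "\<dots> \<le> f x - (norm ?D)\<^sup>2 / L + L / 2 * (norm ?D / L)\<^sup>2"
    using L_smooth_descent[OF assms(1), of "x - (1 / L) *\<^sub>R ?D" x] \<open>L > 0\<close>
    by (simp add: dot_square_norm)
  also have "\<dots> = f x - (norm ?D)\<^sup>2 / (2 * L)"
    using \<open>L > 0\<close> by (simp add: field_simps power2_eq_square)
  finally show ?thesis
    using \<open>L > 0\<close> by (simp add: field_simps)
qed

text \<open>With \<open>m = f xs\<close>, the previous bound at \<open>xs\<close> itself forces the
  gradient there to vanish; only the quadratic term of the descent inequality from \<open>xs\<close>
  survives.\<close>

lemma L_smooth_minimizer_gap:
  assumes "L_smooth L f" and "L > 0" and "\<forall>y. f xs \<le> f y"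
  shows "f x - f xs \<le> L / 2 * (norm (x - xs))\<^sup>2"
proof -
  have "gradient f xs = 0"
    using norm_gradient_sq_le[OF assms(1,2), of "f xs" xs] assms(3) by simp
  then show ?thesis
    using L_smooth_descent[OF assms(1), of x xs] by simp
qed

text \<open>The one-sided inequality in \<open>L_smooth\<close> does not make the gradient Lipschitz
  in general, but when one of the two points is a minimizer the two preceding bounds combine to the
  Lipschitz estimate.\<close>

lemma norm_gradient_le_dist_minimizer:
  assumes "L_smooth L f" and "L > 0" and "\<forall>y. f xs \<le> f y"
  shows "norm (gradient f x) \<le> L * norm (x - xs)"
proof -
  have "(norm (gradient f x))\<^sup>2 \<le> 2 * L * (f x - f xs)"
    using norm_gradient_sq_le assms by blast
  also have "\<dots> \<le> 2 * L * (L / 2 * (norm (x - xs))\<^sup>2)"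
    by (intro mult_left_mono L_smooth_minimizer_gap assms) (use assms in auto)
  also have "\<dots> = (L * norm (x - xs))\<^sup>2"
    by (simp add: power2_eq_square)
  finally show ?thesis
    by (rule power2_le_imp_le) (use assms in auto)
qed

section \<open>The pathwise bound\<close>

lemma norm_diff_sq_le: "(norm (a - b))\<^sup>2 \<le> 2 * (norm a)\<^sup>2 + 2 * (norm b)\<^sup>2"
  for a b :: "'a::real_inner"
proof -
  have "(norm (a - b))\<^sup>2 + (norm (a + b))\<^sup>2 = 2 * (norm a)\<^sup>2 + 2 * (norm b)\<^sup>2"
    by (simp add: power2_norm_eq_inner algebra_simps)
  then show ?thesis
    by (metis le_add_same_cancel1 zero_le_power2)
qed

text \<open>Index 0 is meaningful here: the empty sum gives the initial weight
  \<open>sqrt \<gamma>\<close>, which may be positive.\<close>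

definition inv_step :: "real \<Rightarrow> (nat \<Rightarrow> 'a::euclidean_space) \<Rightarrow> nat \<Rightarrow> real" where
  "inv_step \<gamma> g t = sqrt (\<gamma> + (\<Sum>i=1..t. (norm (g i))\<^sup>2))"

lemma inv_step_nonneg: "\<gamma> \<ge> 0 \<Longrightarrow> 0 \<le> inv_step \<gamma> g t"
  by (simp add: inv_step_def sum_nonneg)

lemma inv_step_sq: "\<gamma> \<ge> 0 \<Longrightarrow> (inv_step \<gamma> g t)\<^sup>2 = \<gamma> + (\<Sum>i=1..t. (norm (g i))\<^sup>2)"
  by (simp add: inv_step_def sum_nonneg)

lemma inv_step_le_Suc: "inv_step \<gamma> g t \<le> inv_step \<gamma> g (Suc t)"
  by (simp add: inv_step_def)

text \<open>The quantity maximized in \<open>B_max\<close>. In \<open>sda_step\<close> its three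
  summands pay, in order, for the inner product of gradient and iterate, the function gap, and the
  squared displacement.\<close>

definition iterate_radius :: "'a::euclidean_space \<Rightarrow> 'a \<Rightarrow> real" where
  "iterate_radius xs y =
     norm (y - xs) * norm y + 1 / 2 * (norm (y - xs))\<^sup>2 + (norm y)\<^sup>2"

text \<open>
  The weights \<^term>\<open>inv_step \<gamma> g\<close> are \<open>\<eta> / \<eta>\<^sub>t\<close>, so the hypothesis on \<open>x\<close> is the SDA update without division.
\<close>

lemma sda_step:
  fixes x g :: "nat \<Rightarrow> 'a::euclidean_space"
  assumes sm: "L_smooth L f" and L: "L > 0" and min: "\<forall>y. f xs \<le> f y" and \<gamma>: "\<gamma> \<ge> 0"
    and step: "\<And>t. inv_step \<gamma> g t *\<^sub>R x (Suc t) = - \<eta> *\<^sub>R (\<Sum>i=1..t. g i)"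
  defines "A \<equiv> inv_step \<gamma> g"
  shows "\<eta> * inner (gradient f (x (Suc t))) (g (Suc t)) \<le>
     A t * (f (x (Suc t)) - f xs) - A (Suc t) * (f (x (Suc (Suc t))) - f xs)
       + L * (A (Suc t) - A t) * (iterate_radius xs (x (Suc t)) + 2 * \<eta>\<^sup>2)"
proof -
  define a b where "a = A t" and "b = A (Suc t)"
  define y z D where "y = x (Suc t)" and "z = x (Suc (Suc t))" and "D = gradient f y"
  define v where "v = g (Suc t)"
  have a: "0 \<le> a" and ab: "a \<le> b"
    using inv_step_nonneg[OF \<gamma>] inv_step_le_Suc by (auto simp: a_def b_def A_def)
  have v: "\<eta> *\<^sub>R v = a *\<^sub>R y - b *\<^sub>R z"
    using step[of t] step[of "Suc t"]
    by (simp add: a_def b_def A_def y_def z_def v_def scaleR_add_right)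
  have "b\<^sup>2 - a\<^sup>2 = (norm v)\<^sup>2"
    by (simp add: a_def b_def A_def v_def inv_step_sq[OF \<gamma>])
  \<comment> \<open>The factor \<open>b - a\<close> is kept because increments of the weights
    telescope; the factor \<open>b\<close> is cancelled in \<open>dist\<close>.\<close>
  then have nv: "(norm v)\<^sup>2 \<le> 2 * (b - a) * b"
  proof -
    have "(norm v)\<^sup>2 = (b - a) * (b + a)"
      using \<open>b\<^sup>2 - a\<^sup>2 = (norm v)\<^sup>2\<close> by (simp add: algebra_simps power2_eq_square)
    also have "\<dots> \<le> (b - a) * (2 * b)"
      using ab by (intro mult_left_mono) auto
    finally show ?thesis by (simp add: algebra_simps)
  qed
  \<comment> \<open>Scaled by \<open>b\<close>, the displacement is a sum of two vectors whose
    squared norms both carry the factor \<open>(b - a) * b\<close>; for the second,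
    \<open>b - a \<le> b\<close> since \<open>a\<close> is nonnegative. If \<open>b = 0\<close>,
    then \<open>a = 0\<close> and both sides vanish.\<close>
  have dist: "b * (norm (z - y))\<^sup>2 \<le> (b - a) * (4 * \<eta>\<^sup>2 + 2 * (norm y)\<^sup>2)"
  proof (cases "b = 0")
    case True
    then show ?thesis using a ab by simp
  next
    case False
    then have "b > 0" using a ab by simp
    have bz: "b *\<^sub>R (z - y) = - (\<eta> *\<^sub>R v) - (b - a) *\<^sub>R y"
      unfolding v by (simp add: algebra_simps)
    have "b * (b * (norm (z - y))\<^sup>2) = (norm (- (\<eta> *\<^sub>R v) - (b - a) *\<^sub>R y))\<^sup>2"
      unfolding bz[symmetric] by (simp add: power_mult_distrib power2_eq_square[of b])
    also have "\<dots> \<le> 2 * (\<eta>\<^sup>2 * (norm v)\<^sup>2) + 2 * ((b - a)\<^sup>2 * (norm y)\<^sup>2)"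
      using norm_diff_sq_le[of "- (\<eta> *\<^sub>R v)" "(b - a) *\<^sub>R y"] by (simp add: power_mult_distrib)
    also have "\<dots> \<le> 2 * (\<eta>\<^sup>2 * (2 * (b - a) * b)) + 2 * ((b - a) * b * (norm y)\<^sup>2)"
      using nv a ab unfolding power2_eq_square[of "b - a"]
      by (intro add_mono mult_left_mono mult_right_mono) auto
    also have "\<dots> = b * ((b - a) * (4 * \<eta>\<^sup>2 + 2 * (norm y)\<^sup>2))"
      by (simp add: algebra_simps)
    finally show ?thesis
      using \<open>b > 0\<close> by simp
  qed
  have "\<eta> * inner D v = inner D (\<eta> *\<^sub>R v)" by simp
  also have "\<dots> = - b * inner D (z - y) + (b - a) * (- inner D y)"
    unfolding v by (simp add: algebra_simps inner_diff_right)
  finally have id: "\<eta> * inner D v = - b * inner D (z - y) + (b - a) * (- inner D y)" .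
  have "b * (f z - f y) \<le> b * (inner D (z - y) + L / 2 * (norm (z - y))\<^sup>2)"
    using L_smooth_descent[OF sm, of z y] a ab by (intro mult_left_mono) (auto simp: D_def)
  moreover have "L / 2 * (b * (norm (z - y))\<^sup>2) \<le> L / 2 * ((b - a) * (4 * \<eta>\<^sup>2 + 2 * (norm y)\<^sup>2))"
    using dist L by (intro mult_left_mono) auto
  moreover have "(b - a) * (- inner D y) \<le> (b - a) * (L * norm (y - xs) * norm y)"
  proof (intro mult_left_mono)
    have "- inner D y \<le> norm D * norm y"
      using Cauchy_Schwarz_ineq2[of D y] by linarith
    also have "\<dots> \<le> L * norm (y - xs) * norm y"
      unfolding D_def by (intro mult_right_mono norm_gradient_le_dist_minimizer[OF sm L min]) auto
    finally show "- inner D y \<le> L * norm (y - xs) * norm y" .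
  qed (use ab in auto)
  \<comment> \<open>Descent produces the gap at \<open>y\<close> with weight \<open>b\<close>, while
    telescoping wants weight \<open>a\<close>; the excess is paid by the quadratic gap
    bound.\<close>
  moreover have "(b - a) * (f y - f xs) \<le> (b - a) * (L / 2 * (norm (y - xs))\<^sup>2)"
    using L_smooth_minimizer_gap[OF sm L min] ab by (intro mult_left_mono) auto
  ultimately have "\<eta> * inner D v \<le> a * (f y - f xs) - b * (f z - f xs)
       + L * (b - a) * (iterate_radius xs y + 2 * \<eta>\<^sup>2)"
    unfolding id iterate_radius_def by (simp add: algebra_simps diff_divide_distrib)
  then show ?thesis
    by (simp add: a_def b_def y_def z_def D_def v_def)
qed

text \<open>Sum \<open>sda_step\<close>: since the weights increase, every radius may be replaced by
  \<open>B\<close>, and the increments collapse to \<open>A T - A 0\<close>. The initial gap, of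
  weight \<open>A 0\<close>, is at most \<open>L * (B + 2 * \<eta>\<^sup>2)\<close>, which is just
  what completes \<open>A T - A 0\<close> to \<open>A T\<close>.\<close>

lemma sda_pathwise:
  fixes x g :: "nat \<Rightarrow> 'a::euclidean_space"
  assumes sm: "L_smooth L f" and L: "L > 0" and min: "\<forall>y. f xs \<le> f y" and \<gamma>: "\<gamma> \<ge> 0"
    and step: "\<And>t. inv_step \<gamma> g t *\<^sub>R x (Suc t) = - \<eta> *\<^sub>R (\<Sum>i=1..t. g i)"
    and B: "\<And>t. t \<in> {1..T} \<Longrightarrow> iterate_radius xs (x t) \<le> B" and T: "T \<ge> 1"
  shows "\<eta> * (\<Sum>t=1..T. inner (gradient f (x t)) (g t)) \<le> L * inv_step \<gamma> g T * (B + 2 * \<eta>\<^sup>2)"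
proof -
  define A where "A = inv_step \<gamma> g"
  have "\<eta> * (\<Sum>t=1..n. inner (gradient f (x t)) (g t)) \<le>
     A 0 * (f (x 1) - f xs) - A n * (f (x (Suc n)) - f xs) + L * (A n - A 0) * (B + 2 * \<eta>\<^sup>2)"
    if "n \<le> T" for n
    using that
  proof (induction n)
    case 0
    then show ?case by simp
  next
    case (Suc n)
    have "L * (A (Suc n) - A n) * (iterate_radius xs (x (Suc n)) + 2 * \<eta>\<^sup>2)
        \<le> L * (A (Suc n) - A n) * (B + 2 * \<eta>\<^sup>2)"
      using B[of "Suc n"] Suc.prems L inv_step_le_Suc[of \<gamma> g n]
      by (intro mult_left_mono) (auto simp: A_def)
    then show ?case
      using Suc sda_step[OF sm L min \<gamma> step, where t = n]
      unfolding A_def by (simp add: algebra_simps)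
  qed
  from this[of T]
  have "\<eta> * (\<Sum>t=1..T. inner (gradient f (x t)) (g t)) \<le>
     A 0 * (f (x 1) - f xs) - A T * (f (x (Suc T)) - f xs) + L * (A T - A 0) * (B + 2 * \<eta>\<^sup>2)"
    by simp
  \<comment> \<open>The final gap is dropped by minimality of \<open>xs\<close>;
    \<open>T \<ge> 1\<close> puts the first iterate among those controlled by
    \<open>B\<close>.\<close>
  also have "\<dots> \<le> A 0 * (L * (B + 2 * \<eta>\<^sup>2)) - 0 + L * (A T - A 0) * (B + 2 * \<eta>\<^sup>2)"
  proof (intro add_right_mono diff_mono mult_left_mono)
    have "f (x 1) - f xs \<le> L / 2 * (norm (x 1 - xs))\<^sup>2"
      by (rule L_smooth_minimizer_gap[OF sm L min])
    also have "\<dots> \<le> L * iterate_radius xs (x 1)"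
      using L by (simp add: iterate_radius_def distrib_left)
    also have "\<dots> \<le> L * (B + 2 * \<eta>\<^sup>2)"
      using B[of 1] T L by (intro mult_left_mono) (auto intro: add_increasing2)
    finally show "f (x 1) - f xs \<le> L * (B + 2 * \<eta>\<^sup>2)" .
  next
    show "0 \<le> A T * (f (x (Suc T)) - f xs)"
      using min inv_step_nonneg[OF \<gamma>, of g] by (simp add: A_def)
  qed (use inv_step_nonneg[OF \<gamma>, of g] in \<open>simp add: A_def\<close>)
  also have "\<dots> = L * A T * (B + 2 * \<eta>\<^sup>2)"
    by (simp add: algebra_simps)
  finally show ?thesis by (simp add: A_def)
qed

text \<open>The product form survives a skipped update: a zero gradient changes neither the weight
  nor the sum, so the old identity persists even if the weight is 0. At every other step the new
  weight is nonzero and cancels.\<close>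

lemma adaptive_sda_run_step:
  fixes x g :: "nat \<Rightarrow> 'w \<Rightarrow> 'a::euclidean_space"
  assumes run: "adaptive_sda_run M G \<eta> \<gamma> x g" and \<gamma>: "\<gamma> \<ge> 0" and \<omega>: "\<omega> \<in> space M"
  shows "inv_step \<gamma> (\<lambda>t. g t \<omega>) t *\<^sub>R x (Suc t) \<omega> = - \<eta> *\<^sub>R (\<Sum>i=1..t. g i \<omega>)"
proof (induction t)
  case 0
  then show ?case
    using run \<omega> by (simp add: adaptive_sda_run_def)
next
  case (Suc t)
  let ?A = "inv_step \<gamma> (\<lambda>t. g t \<omega>)"
  have upd: "x (Suc (Suc t)) \<omega> =
      (if \<gamma> = 0 \<and> g (Suc t) \<omega> = 0 then x (Suc t) \<omega>
       else - adaptive_step \<eta> \<gamma> g (Suc t) \<omega> *\<^sub>R (\<Sum>i=1..Suc t. g i \<omega>))"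
    using run \<omega> unfolding adaptive_sda_run_def by (metis Suc_eq_plus1 le_add2)
  show ?case
  proof (cases "\<gamma> = 0 \<and> g (Suc t) \<omega> = 0")
    case True
    then have "?A (Suc t) = ?A t" by (simp add: inv_step_def)
    then show ?thesis using Suc upd True by simp
  next
    case False
    have "?A (Suc t) \<noteq> 0"
    proof
      assume "?A (Suc t) = 0"
      then have "\<gamma> + (\<Sum>i=1..t. (norm (g i \<omega>))\<^sup>2) + (norm (g (Suc t) \<omega>))\<^sup>2 = 0"
        by (simp add: inv_step_def)
      moreover have "0 \<le> (\<Sum>i=1..t. (norm (g i \<omega>))\<^sup>2)" by (simp add: sum_nonneg)
      ultimately have "\<gamma> = 0" "(norm (g (Suc t) \<omega>))\<^sup>2 = 0"
        using \<gamma> zero_le_power2[of "norm (g (Suc t) \<omega>)"] by linarith+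
      then show False using False by simp
    qed
    moreover have "adaptive_step \<eta> \<gamma> g (Suc t) \<omega> = \<eta> / ?A (Suc t)"
      by (simp only: adaptive_step_def inv_step_def)
    ultimately have "?A (Suc t) * - adaptive_step \<eta> \<gamma> g (Suc t) \<omega> = - \<eta>"
      by simp
    then show ?thesis
      unfolding upd if_not_P[OF False] scaleR_scaleR by (simp only:)
  qed
qed

section \<open>Measurability with respect to the past\<close>

lemma space_past [simp]: "space (past M \<xi> t) = space M"
  unfolding past_def by (rule space_measure_of) auto

lemma past_gen_subset:
  "(\<Union>i\<in>{1..<t}. {\<xi> i -` A \<inter> space M | A. A \<in> sets borel}) \<subseteq> Pow (space M)"
  by auto

lemma sets_past:
  "sets (past M \<xi> t) =
     sigma_sets (space M) (\<Union>i\<in>{1..<t}. {\<xi> i -` A \<inter> space M | A. A \<in> sets borel})"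
  unfolding past_def by (rule sets_measure_of[OF past_gen_subset])

lemma measurable_past:
  assumes "i \<in> {1..<t}"
  shows "\<xi> i \<in> borel_measurable (past M \<xi> t)"
proof (rule measurableI)
  fix A :: "'b set" assume "A \<in> sets borel"
  then show "\<xi> i -` A \<inter> space (past M \<xi> t) \<in> sets (past M \<xi> t)"
    unfolding sets_past space_past using assms by (intro sigma_sets.Basic) blast
qed simp

lemma subalgebra_past:
  assumes "\<And>i. i \<in> {1..<t} \<Longrightarrow> \<xi> i \<in> borel_measurable M"
  shows "subalgebra M (past M \<xi> t)"
  unfolding subalgebra_def sets_past space_past
  using assms by (auto intro!: sets.sigma_sets_subset measurable_sets)

text \<open>The measure \<open>N\<close> is arbitrary so that the lemma serves both \<open>M\<close>
  and the past. For the past, measurability of \<open>g i\<close> is obtained from that of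
  \<open>x i\<close>, hence the conditional form of the hypothesis and the strong induction.\<close>

lemma adaptive_sda_run_measurable:
  fixes x g :: "nat \<Rightarrow> 'w \<Rightarrow> 'a::euclidean_space"
  assumes run: "adaptive_sda_run M G \<eta> \<gamma> x g"
    and sp: "space N = space M"
    and g: "\<And>i. i \<in> {1..<t} \<Longrightarrow> x i \<in> borel_measurable N \<Longrightarrow> g i \<in> borel_measurable N"
    and s: "s \<in> {1..t}"
  shows "x s \<in> borel_measurable N"
  using s
proof (induction s rule: less_induct)
  case (less s)
  show ?case
  proof (cases "s = 1")
    case True
    \<comment> \<open>The run is prescribed only on \<open>space M\<close>, so functions are
      compared through \<open>measurable_cong\<close>.\<close>
    have "x 1 \<in> borel_measurable N \<longleftrightarrow> (\<lambda>_. 0 :: 'a) \<in> borel_measurable N"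
      by (rule measurable_cong) (use run sp in \<open>auto simp: adaptive_sda_run_def\<close>)
    then show ?thesis using True by simp
  next
    case False
    then obtain r where r: "s = r + 1" "r \<ge> 1"
      using less.prems by (metis Suc_eq_plus1 atLeastAtMost_iff le_Suc_eq not_less_eq_eq old.nat.exhaust One_nat_def)
    have gm[measurable]: "g i \<in> borel_measurable N" if "i \<in> {1..r}" for i
      using less that r by (intro g) auto
    have [measurable]: "x r \<in> borel_measurable N" "g r \<in> borel_measurable N"
      using less r gm by auto
    have [measurable]: "(\<lambda>\<omega>. \<Sum>i=1..r. g i \<omega>) \<in> borel_measurable N"
      "(\<lambda>\<omega>. \<Sum>i=1..r. (norm (g i \<omega>))\<^sup>2) \<in> borel_measurable N"
      by measurable
    have "x s \<in> borel_measurable N \<longleftrightarrow> (\<lambda>\<omega>. if \<gamma> = 0 \<and> g r \<omega> = 0 then x r \<omega>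
            else - adaptive_step \<eta> \<gamma> g r \<omega> *\<^sub>R (\<Sum>i=1..r. g i \<omega>)) \<in> borel_measurable N"
      by (rule measurable_cong) (use run sp r in \<open>auto simp: adaptive_sda_run_def\<close>)
    also have \<dots>
      unfolding adaptive_step_def by measurable
    finally show ?thesis .
  qed
qed

section \<open>Expectations\<close>

lemma integrable_inner_L2:
  fixes u v :: "'w \<Rightarrow> 'a::euclidean_space"
  assumes [measurable]: "u \<in> borel_measurable M" "v \<in> borel_measurable M"
    and "integrable M (\<lambda>\<omega>. (norm (u \<omega>))\<^sup>2)" "integrable M (\<lambda>\<omega>. (norm (v \<omega>))\<^sup>2)"
  shows "integrable M (\<lambda>\<omega>. inner (u \<omega>) (v \<omega>))"
proof (rule Bochner_Integration.integrable_bound)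
  show "integrable M (\<lambda>\<omega>. (norm (u \<omega>))\<^sup>2 + (norm (v \<omega>))\<^sup>2)"
    using assms by simp
  have "\<bar>inner (u \<omega>) (v \<omega>)\<bar> \<le> (norm (u \<omega>))\<^sup>2 + (norm (v \<omega>))\<^sup>2" for \<omega>
  proof -
    have "0 \<le> (norm (u \<omega>) - norm (v \<omega>))\<^sup>2" "0 \<le> norm (u \<omega>) * norm (v \<omega>)" by simp_all
    then show ?thesis
      using Cauchy_Schwarz_ineq2[of "u \<omega>" "v \<omega>"] unfolding power2_diff by linarith
  qed
  then show "AE \<omega> in M. norm (inner (u \<omega>) (v \<omega>)) \<le> norm ((norm (u \<omega>))\<^sup>2 + (norm (v \<omega>))\<^sup>2)"
    by (intro AE_I2) (simp add: order_trans[OF _ abs_ge_self])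
qed measurable

lemma integrable_nn_integral_le:
  fixes h :: "'w \<Rightarrow> real"
  assumes h: "h \<in> borel_measurable M" "\<And>\<omega>. h \<omega> \<ge> 0" and c: "c \<ge> 0"
    and le: "(\<integral>\<^sup>+\<omega>. ennreal (h \<omega>) \<partial>M) \<le> ennreal c"
  shows "integrable M h" and "(\<integral>\<omega>. h \<omega> \<partial>M) \<le> c"
proof -
  show int: "integrable M h"
    using h le by (intro integrableI_bounded) (auto simp: le_less_trans[OF _ ennreal_less_top])
  show "(\<integral>\<omega>. h \<omega> \<partial>M) \<le> c"
    using le c h by (simp add: nn_integral_eq_integral[OF int])
qed

lemma integral_Cauchy_Schwarz:
  fixes u v :: "'w \<Rightarrow> real"
  assumes [measurable]: "u \<in> borel_measurable M" "v \<in> borel_measurable M"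
    and u: "integrable M (\<lambda>\<omega>. (u \<omega>)\<^sup>2)" and v: "integrable M (\<lambda>\<omega>. (v \<omega>)\<^sup>2)"
  shows "(\<integral>\<omega>. u \<omega> * v \<omega> \<partial>M) \<le> sqrt (\<integral>\<omega>. (u \<omega>)\<^sup>2 \<partial>M) * sqrt (\<integral>\<omega>. (v \<omega>)\<^sup>2 \<partial>M)"
proof -
  have i: "integrable M (\<lambda>\<omega>. u \<omega> * v \<omega>)"
    using integrable_inner_L2[of u M v] u v by simp
  have "(\<integral>\<omega>. u \<omega> * v \<omega> \<partial>M) \<le> (\<integral>\<omega>. \<bar>u \<omega>\<bar> * \<bar>v \<omega>\<bar> \<partial>M)"
    using i by (intro integral_mono) (auto simp: abs_mult[symmetric])
  also have "\<dots> \<le> sqrt ((\<integral>\<omega>. (u \<omega>)\<^sup>2 \<partial>M) * (\<integral>\<omega>. (v \<omega>)\<^sup>2 \<partial>M))"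
  proof (rule real_le_rsqrt)
    have "ennreal ((\<integral>\<omega>. \<bar>u \<omega>\<bar> * \<bar>v \<omega>\<bar> \<partial>M)\<^sup>2) = (\<integral>\<^sup>+\<omega>. ennreal \<bar>u \<omega>\<bar> * ennreal \<bar>v \<omega>\<bar> \<partial>M)\<^sup>2"
      using i by (subst ennreal_mult[symmetric], simp, simp, subst nn_integral_eq_integral)
        (auto simp: abs_mult[symmetric] ennreal_power)
    also have "\<dots> \<le> (\<integral>\<^sup>+\<omega>. (ennreal \<bar>u \<omega>\<bar>)\<^sup>2 \<partial>M) * (\<integral>\<^sup>+\<omega>. (ennreal \<bar>v \<omega>\<bar>)\<^sup>2 \<partial>M)"
      by (rule Cauchy_Schwarz_nn_integral) measurable
    also have "\<dots> = ennreal ((\<integral>\<omega>. (u \<omega>)\<^sup>2 \<partial>M) * (\<integral>\<omega>. (v \<omega>)\<^sup>2 \<partial>M))"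
      using u v by (simp add: ennreal_power nn_integral_eq_integral ennreal_mult)
    finally show "(\<integral>\<omega>. \<bar>u \<omega>\<bar> * \<bar>v \<omega>\<bar> \<partial>M)\<^sup>2 \<le> (\<integral>\<omega>. (u \<omega>)\<^sup>2 \<partial>M) * (\<integral>\<omega>. (v \<omega>)\<^sup>2 \<partial>M)"
      by (simp add: ennreal_le_iff)
  qed
  finally show ?thesis by (simp add: real_sqrt_mult)
qed

text \<open>Coordinatewise, the \<open>F\<close>-measurable factor moves past the conditional
  expectation. \<open>real_cond_exp_intg\<close> asks for integrability of the product, which square
  integrability of both factors supplies.\<close>

lemma (in sigma_finite_subalgebra) integral_inner_cond_exp_zero:
  fixes u v :: "'a \<Rightarrow> 'b::euclidean_space"
  assumes u: "u \<in> borel_measurable F" and [measurable]: "v \<in> borel_measurable M"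
    and u2: "integrable M (\<lambda>\<omega>. (norm (u \<omega>))\<^sup>2)" and v2: "integrable M (\<lambda>\<omega>. (norm (v \<omega>))\<^sup>2)"
    and zero: "\<And>b. b \<in> Basis \<Longrightarrow> AE \<omega> in M. real_cond_exp M F (\<lambda>\<omega>. inner (v \<omega>) b) \<omega> = 0"
  shows "(\<integral>\<omega>. inner (u \<omega>) (v \<omega>) \<partial>M) = 0"
proof -
  have uM[measurable]: "u \<in> borel_measurable M"
    using u by (rule measurable_from_subalg[OF subalg])
  have coord: "integrable M (\<lambda>\<omega>. inner (u \<omega>) b * inner (v \<omega>) b)"
    "(\<integral>\<omega>. inner (u \<omega>) b * inner (v \<omega>) b \<partial>M) = 0" if b: "b \<in> Basis" for b
  proof -
    have sq: "integrable M (\<lambda>\<omega>. (inner (w \<omega>) b)\<^sup>2)"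
      if [measurable]: "w \<in> borel_measurable M" and w: "integrable M (\<lambda>\<omega>. (norm (w \<omega>))\<^sup>2)" for w
    proof (rule Bochner_Integration.integrable_bound[OF w])
      have "\<bar>inner (w \<omega>) b\<bar>\<^sup>2 \<le> (norm (w \<omega>))\<^sup>2" for \<omega>
        by (intro power_mono) (use Basis_le_norm[OF b] in auto)
      then show "AE \<omega> in M. norm ((inner (w \<omega>) b)\<^sup>2) \<le> norm ((norm (w \<omega>))\<^sup>2)"
        by (intro AE_I2) simp
    qed measurable
    show int: "integrable M (\<lambda>\<omega>. inner (u \<omega>) b * inner (v \<omega>) b)"
      using integrable_inner_L2[of "\<lambda>\<omega>. inner (u \<omega>) b" M "\<lambda>\<omega>. inner (v \<omega>) b"] sq u2 v2 by simp
    have "(\<integral>\<omega>. inner (u \<omega>) b * inner (v \<omega>) b \<partial>M)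
        = (\<integral>\<omega>. inner (u \<omega>) b * real_cond_exp M F (\<lambda>\<omega>. inner (v \<omega>) b) \<omega> \<partial>M)"
      by (rule real_cond_exp_intg(2)[OF int, symmetric]) (use u in measurable)
    also have "\<dots> = (\<integral>\<omega>. 0 \<partial>M)"
      using zero[OF b] by (intro integral_cong_AE) auto
    finally show "(\<integral>\<omega>. inner (u \<omega>) b * inner (v \<omega>) b \<partial>M) = 0" by simp
  qed
  have "(\<integral>\<omega>. inner (u \<omega>) (v \<omega>) \<partial>M) = (\<integral>\<omega>. (\<Sum>b\<in>Basis. inner (u \<omega>) b * inner (v \<omega>) b) \<partial>M)"
    by (simp add: euclidean_inner[symmetric])
  also have "\<dots> = 0"
    using coord by simp
  finally show ?thesis .
qed

text \<open>The tower property: the defining identity of \<open>nn_cond_exp\<close> tested against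
  the constant 1.\<close>

lemma (in sigma_finite_subalgebra) nn_integral_le_nn_cond_exp_bound:
  assumes "h \<in> borel_measurable M" and "AE \<omega> in M. nn_cond_exp M F h \<omega> \<le> k \<omega>"
  shows "(\<integral>\<^sup>+\<omega>. h \<omega> \<partial>M) \<le> (\<integral>\<^sup>+\<omega>. k \<omega> \<partial>M)"
  using nn_cond_exp_intg[of "\<lambda>_. 1" h] nn_integral_mono_AE[OF assms(2)] assms(1) by simp

text \<open>Split the root by subadditivity and double the inequality. Completing squares turns the
  \<open>r * n\<close> part into \<open>n + c\<^sup>2 * r\<close>, whose \<open>n\<close> is
  absorbed on the left, and the \<open>p\<close> part into \<open>p / 2 + 2 * c\<^sup>2\<close>. The
  root of \<open>q\<close> is left alone; it becomes the term of order sqrt T.\<close>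

lemma sqrt_self_bound:
  fixes n c p q r :: real
  assumes n: "n \<le> c * sqrt (p + q + r * n)" and nn: "n \<ge> 0" "c \<ge> 0" "p \<ge> 0" "q \<ge> 0" "r \<ge> 0"
  shows "n \<le> 2 * c * sqrt q + p / 2 + c\<^sup>2 * (2 + r)"
proof -
  have "n \<le> c * (sqrt p + sqrt q + sqrt (r * n))"
    using n sqrt_add_le_add_sqrt[of "p + q" "r * n"] sqrt_add_le_add_sqrt[of p q] nn
    by (smt (verit) mult_left_mono mult_nonneg_nonneg)
  moreover have "2 * c * sqrt (r * n) \<le> n + c\<^sup>2 * r"
  proof -
    have "0 \<le> (sqrt n - c * sqrt r)\<^sup>2" by simp
    then show ?thesis
      using nn by (simp add: power2_diff power_mult_distrib real_sqrt_mult algebra_simps)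
  qed
  moreover have "2 * c * sqrt p \<le> p / 2 + 2 * c\<^sup>2"
  proof -
    have "0 \<le> (sqrt p - 2 * c)\<^sup>2" by simp
    then show ?thesis
      using nn by (simp add: power2_diff power_mult_distrib algebra_simps)
  qed
  ultimately show ?thesis
    by (simp add: algebra_simps)
qed

theorem theorem6p1:
  fixes M :: "'w measure"
    and f :: "'a::euclidean_space \<Rightarrow> real"
    and G :: "('w, 'a) grad_oracle"
    and x g :: "nat \<Rightarrow> 'w \<Rightarrow> 'a"
    and L \<rho> \<sigma> \<eta> \<gamma> :: real
    and xs :: 'a
    and T :: nat
  assumes "prob_space M"
    and "L > 0" and "L_smooth L f" and "bdd_below (range f)"
    and "\<rho> \<ge> 0" and "\<sigma> \<ge> 0"
    and "unbiased_oracle M f G" and "strong_growth_oracle M f \<rho> \<sigma> G"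
    and "\<eta> > 0" and "\<gamma> \<ge> 0"
    and "adaptive_sda_run M G \<eta> \<gamma> x g"
    and "unbiased_along M f x g" and "strong_growth_along M f \<rho> \<sigma> x g"
    and "\<forall>y. f xs \<le> f y"
    and "T \<ge> 1"
  shows "(\<Sum>t=1..T. \<integral>\<^sup>+\<omega>. ennreal ((norm (gradient f (x t \<omega>)))\<^sup>2) \<partial>M)
    \<le> ennreal (2 * sqrt 2 * L * \<sigma>)
          * ennreal_sqrt (\<integral>\<^sup>+\<omega>. ennreal ((B_max xs x T \<omega> / \<eta> + 2 * \<eta>)\<^sup>2) \<partial>M)
          * ennreal (sqrt (real T))
      + ennreal (2 * sqrt 2 * L\<^sup>2 * (sqrt 2 + \<rho>))
          * (\<integral>\<^sup>+\<omega>. ennreal ((B_max xs x T \<omega> / \<eta> + 2 * \<eta>)\<^sup>2) \<partial>M)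
      + ennreal (\<gamma> / 2)
      + ennreal (2 * (f 0 - (INF y. f y)) / \<eta>)"
proof -
  interpret prob_space M by fact
  note L = \<open>L > 0\<close> and sm = \<open>L_smooth L f\<close> and min = \<open>\<forall>y. f xs \<le> f y\<close>
    and \<eta> = \<open>\<eta> > 0\<close> and \<gamma> = \<open>\<gamma> \<ge> 0\<close> and run = \<open>adaptive_sda_run M G \<eta> \<gamma> x g\<close>
  define D \<xi> where "D t \<omega> = gradient f (x t \<omega>)" and "\<xi> = noise f x g" for t \<omega>
  define F where "F = past M \<xi>"
  define A where "A \<omega> = inv_step \<gamma> (\<lambda>t. g t \<omega>) T" for \<omega>
  define W where "W \<omega> = B_max xs x T \<omega> / \<eta> + 2 * \<eta>" for \<omega>
  have [measurable]: "gradient f \<in> borel_measurable borel"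
    using sm by (intro borel_measurable_gradient) (simp add: L_smooth_def)
  have g_eq: "g t = (\<lambda>\<omega>. \<xi> t \<omega> + D t \<omega>)" for t
    by (simp add: \<xi>_def D_def noise_def fun_eq_iff)
  have g_meas[measurable]: "g t \<in> borel_measurable M" if "t \<ge> 1" for t
    using run that by (simp add: adaptive_sda_run_def)
  have x_meas[measurable]: "x t \<in> borel_measurable M" if "t \<ge> 1" for t
    by (rule adaptive_sda_run_measurable[OF run refl, where t = t]) (use that g_meas in auto)
  have D_meas[measurable]: "D t \<in> borel_measurable M" if "t \<ge> 1" for t
    unfolding D_def using x_meas[OF that] by measurable
  have \<xi>_meas[measurable]: "\<xi> t \<in> borel_measurable M" if "t \<ge> 1" for t
    unfolding \<xi>_def noise_def using g_meas[OF that] x_meas[OF that] by measurable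
  have sub: "subalgebra M (F t)" for t
    unfolding F_def by (rule subalgebra_past) (use \<xi>_meas in auto)
  have fin_sub: "finite_measure_subalgebra M (F t)" for t
    by unfold_locales (rule sub)
  \<comment> \<open>\<open>F t\<close> is generated by the noise, not by the gradients:
    \<open>g i\<close> is rebuilt as noise plus the gradient at \<open>x i\<close>.\<close>
  have "x t \<in> borel_measurable (F t)" if "t \<ge> 1" for t
  proof (rule adaptive_sda_run_measurable[OF run, where t = t])
    fix i assume i: "i \<in> {1..<t}" and [measurable]: "x i \<in> borel_measurable (F t)"
    have [measurable]: "\<xi> i \<in> borel_measurable (F t)"
      unfolding F_def using i by (rule measurable_past)
    show "g i \<in> borel_measurable (F t)"
      unfolding g_eq D_def by measurable
  qed (use that in \<open>auto simp: F_def\<close>)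
  then have D_past: "D t \<in> borel_measurable (F t)" if "t \<ge> 1" for t
    unfolding D_def using that by measurable
  have radius: "iterate_radius xs (x t \<omega>) \<le> B_max xs x T \<omega>" if "t \<in> {1..T}" for t \<omega>
    unfolding B_max_def iterate_radius_def using that by (intro Max_ge) auto
  have [measurable]: "B_max xs x T \<in> borel_measurable M"
    unfolding B_max_def by measurable
  then have W_meas[measurable]: "W \<in> borel_measurable M"
    unfolding W_def by measurable
  have [measurable]: "A \<in> borel_measurable M"
    unfolding A_def inv_step_def by measurable
  have W_eq: "B_max xs x T \<omega> + 2 * \<eta>\<^sup>2 = \<eta> * W \<omega>" for \<omega>
    using \<eta> by (simp add: W_def field_simps power2_eq_square)
  let ?W2 = "\<integral>\<^sup>+\<omega>. ennreal ((W \<omega>)\<^sup>2) \<partial>M"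
  \<comment> \<open>As the initial gap is already absorbed into \<open>W\<close>, three summands
    bound the left side; the remaining summand of the theorem, nonnegative as an
    \<open>ennreal\<close>, is added at the very end.\<close>
  have "(\<Sum>t=1..T. \<integral>\<^sup>+\<omega>. ennreal ((norm (D t \<omega>))\<^sup>2) \<partial>M)
    \<le> ennreal (2 * sqrt 2 * L * \<sigma>) * ennreal_sqrt ?W2 * ennreal (sqrt (real T))
      + ennreal (2 * sqrt 2 * L\<^sup>2 * (sqrt 2 + \<rho>)) * ?W2 + ennreal (\<gamma> / 2)"
  proof (cases "?W2 = \<top>")
    case True
    \<comment> \<open>The infinite value must come from the second summand: for \<sigma> = 0 the
      first one is 0 even when the second moment of \<open>W\<close> is infinite.\<close>
    have "0 < sqrt 2 + \<rho>"
      using \<open>\<rho> \<ge> 0\<close> by (simp add: add_pos_nonneg)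
    then have "ennreal (2 * sqrt 2 * L\<^sup>2 * (sqrt 2 + \<rho>)) * ?W2 = \<top>"
      unfolding True using L by (simp add: ennreal_mult_top)
    then show ?thesis by simp
  next
    case False
    define w where "w = (\<integral>\<omega>. (W \<omega>)\<^sup>2 \<partial>M)"
    define n where "n t = (\<integral>\<omega>. (norm (D t \<omega>))\<^sup>2 \<partial>M)" for t
    have W2: "integrable M (\<lambda>\<omega>. (W \<omega>)\<^sup>2)"
      using False by (intro integrableI_bounded) (auto simp: top.not_eq_extremum)
    then have "integrable M W"
      by (rule square_integrable_imp_integrable[OF W_meas])
    \<comment> \<open>The squared gradient norm is at most \<open>2 * L\<^sup>2\<close> times the
      radius, hence dominated by a multiple of \<open>W\<close>, which is integrable because
      \<open>W\<close> is square integrable on a probability space.\<close>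
    have D2: "integrable M (\<lambda>\<omega>. (norm (D t \<omega>))\<^sup>2)" if t: "t \<in> {1..T}" for t
    proof (rule Bochner_Integration.integrable_bound)
      show "integrable M (\<lambda>\<omega>. 2 * L\<^sup>2 * \<eta> * W \<omega>)"
        using \<open>integrable M W\<close> by simp
      show "AE \<omega> in M. norm ((norm (D t \<omega>))\<^sup>2) \<le> norm (2 * L\<^sup>2 * \<eta> * W \<omega>)"
      proof (rule AE_I2)
        fix \<omega>
        have "(norm (D t \<omega>))\<^sup>2 \<le> (L * norm (x t \<omega> - xs))\<^sup>2"
          unfolding D_def by (intro power_mono norm_gradient_le_dist_minimizer[OF sm L min]) auto
        also have "\<dots> = 2 * L\<^sup>2 * (1 / 2 * (norm (x t \<omega> - xs))\<^sup>2)"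
          by (simp add: power_mult_distrib)
        also have "\<dots> \<le> 2 * L\<^sup>2 * (\<eta> * W \<omega>)"
        proof (intro mult_left_mono)
          have "1 / 2 * (norm (x t \<omega> - xs))\<^sup>2 \<le> iterate_radius xs (x t \<omega>)"
            by (simp add: iterate_radius_def)
          also have "\<dots> \<le> \<eta> * W \<omega>"
            using radius[OF t, of \<omega>] unfolding W_eq[symmetric] by (simp add: add_increasing2)
          finally show "1 / 2 * (norm (x t \<omega> - xs))\<^sup>2 \<le> \<eta> * W \<omega>" .
        qed simp
        finally show "norm ((norm (D t \<omega>))\<^sup>2) \<le> norm (2 * L\<^sup>2 * \<eta> * W \<omega>)"
          by (simp add: mult.assoc)
      qed
    qed (use t D_meas[of t] in auto)
    have \<xi>_bound: "(\<integral>\<^sup>+\<omega>. ennreal ((norm (\<xi> t \<omega>))\<^sup>2) \<partial>M) \<le> ennreal (\<rho> * n t + \<sigma>\<^sup>2)"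
      if t: "t \<in> {1..T}" for t
    proof -
      interpret finite_measure_subalgebra M "F t" by (rule fin_sub)
      have "(\<integral>\<^sup>+\<omega>. ennreal ((norm (\<xi> t \<omega>))\<^sup>2) \<partial>M)
          \<le> (\<integral>\<^sup>+\<omega>. ennreal (\<rho> * (norm (D t \<omega>))\<^sup>2 + \<sigma>\<^sup>2) \<partial>M)"
      proof (rule nn_integral_le_nn_cond_exp_bound)
        show "AE \<omega> in M. nn_cond_exp M (F t) (\<lambda>\<omega>. ennreal ((norm (\<xi> t \<omega>))\<^sup>2)) \<omega>
            \<le> ennreal (\<rho> * (norm (D t \<omega>))\<^sup>2 + \<sigma>\<^sup>2)"
          using \<open>strong_growth_along M f \<rho> \<sigma> x g\<close> t
          unfolding strong_growth_along_def F_def \<xi>_def D_def by simp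
      qed (use t \<xi>_meas[of t] in auto)
      also have "\<dots> = ennreal (\<rho> * n t + \<sigma>\<^sup>2)"
        using D2[OF t] \<open>\<rho> \<ge> 0\<close> by (subst nn_integral_eq_integral) (auto simp: n_def prob_space)
      finally show ?thesis .
    qed
    have \<xi>2: "integrable M (\<lambda>\<omega>. (norm (\<xi> t \<omega>))\<^sup>2)"
        "(\<integral>\<omega>. (norm (\<xi> t \<omega>))\<^sup>2 \<partial>M) \<le> \<rho> * n t + \<sigma>\<^sup>2" if t: "t \<in> {1..T}" for t
    proof -
      have "(\<lambda>\<omega>. (norm (\<xi> t \<omega>))\<^sup>2) \<in> borel_measurable M"
        using \<xi>_meas[of t] t by simp
      moreover have "0 \<le> \<rho> * n t + \<sigma>\<^sup>2"
        using \<open>\<rho> \<ge> 0\<close> by (simp add: n_def)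
      ultimately show "integrable M (\<lambda>\<omega>. (norm (\<xi> t \<omega>))\<^sup>2)"
          "(\<integral>\<omega>. (norm (\<xi> t \<omega>))\<^sup>2 \<partial>M) \<le> \<rho> * n t + \<sigma>\<^sup>2"
        by (rule integrable_nn_integral_le[OF _ zero_le_power2 _ \<xi>_bound[OF t]])+
    qed
    \<comment> \<open>The cross term of gradient and noise has mean zero, because \<open>D t\<close>
      is measurable with respect to the past \<open>F t\<close>.\<close>
    have Dg: "integrable M (\<lambda>\<omega>. inner (D t \<omega>) (g t \<omega>))"
        "(\<integral>\<omega>. inner (D t \<omega>) (g t \<omega>) \<partial>M) = n t" if t: "t \<in> {1..T}" for t
    proof -
      interpret finite_measure_subalgebra M "F t" by (rule fin_sub)
      have t1: "t \<ge> 1" using t by simp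
      have int: "integrable M (\<lambda>\<omega>. inner (D t \<omega>) (\<xi> t \<omega>))"
        by (rule integrable_inner_L2[OF D_meas[OF t1] \<xi>_meas[OF t1] D2[OF t] \<xi>2(1)[OF t]])
      have "(\<integral>\<omega>. inner (D t \<omega>) (\<xi> t \<omega>) \<partial>M) = 0"
      proof (rule integral_inner_cond_exp_zero[OF D_past[OF t1] \<xi>_meas[OF t1] D2[OF t] \<xi>2(1)[OF t]])
        show "AE \<omega> in M. real_cond_exp M (F t) (\<lambda>\<omega>. inner (\<xi> t \<omega>) b) \<omega> = 0" if "b \<in> Basis" for b
          using \<open>unbiased_along M f x g\<close> t1 that unfolding unbiased_along_def F_def \<xi>_def by simp
      qed
      then show "integrable M (\<lambda>\<omega>. inner (D t \<omega>) (g t \<omega>))"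
          "(\<integral>\<omega>. inner (D t \<omega>) (g t \<omega>) \<partial>M) = n t"
        using int D2[OF t] by (simp_all add: g_eq inner_add_right dot_square_norm n_def)
    qed
    have A2_eq: "(A \<omega>)\<^sup>2 = \<gamma> + (\<Sum>t=1..T. (norm (g t \<omega>))\<^sup>2)" for \<omega>
      unfolding A_def by (rule inv_step_sq[OF \<gamma>])
    \<comment> \<open>A pathwise split without a cross term; it is the source of the factor 2 in
      front of \<open>\<sigma>\<^sup>2\<close> and \<open>1 + \<rho>\<close> below.\<close>
    have g2_le: "(norm (g t \<omega>))\<^sup>2 \<le> 2 * (norm (D t \<omega>))\<^sup>2 + 2 * (norm (\<xi> t \<omega>))\<^sup>2" for t \<omega>
      using norm_diff_sq_le[of "D t \<omega>" "- \<xi> t \<omega>"] by (simp add: g_eq add.commute)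
    have g2: "integrable M (\<lambda>\<omega>. (norm (g t \<omega>))\<^sup>2)"
        "(\<integral>\<omega>. (norm (g t \<omega>))\<^sup>2 \<partial>M) \<le> 2 * \<sigma>\<^sup>2 + 2 * (1 + \<rho>) * n t" if t: "t \<in> {1..T}" for t
    proof -
      have int: "integrable M (\<lambda>\<omega>. 2 * (norm (D t \<omega>))\<^sup>2 + 2 * (norm (\<xi> t \<omega>))\<^sup>2)"
        using D2[OF t] \<xi>2(1)[OF t] by simp
      show ig: "integrable M (\<lambda>\<omega>. (norm (g t \<omega>))\<^sup>2)"
        by (rule Bochner_Integration.integrable_bound[OF int]) (use t g2_le in auto)
      have "(\<integral>\<omega>. (norm (g t \<omega>))\<^sup>2 \<partial>M) \<le> (\<integral>\<omega>. 2 * (norm (D t \<omega>))\<^sup>2 + 2 * (norm (\<xi> t \<omega>))\<^sup>2 \<partial>M)"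
        by (intro integral_mono ig int g2_le)
      also have "\<dots> = 2 * n t + 2 * (\<integral>\<omega>. (norm (\<xi> t \<omega>))\<^sup>2 \<partial>M)"
        using D2[OF t] \<xi>2(1)[OF t] by (simp add: n_def)
      also have "\<dots> \<le> 2 * \<sigma>\<^sup>2 + 2 * (1 + \<rho>) * n t"
        using \<xi>2(2)[OF t] by (simp add: algebra_simps)
      finally show "(\<integral>\<omega>. (norm (g t \<omega>))\<^sup>2 \<partial>M) \<le> 2 * \<sigma>\<^sup>2 + 2 * (1 + \<rho>) * n t" .
    qed
    define m where "m = (\<Sum>t=1..T. n t)"
    have A2: "integrable M (\<lambda>\<omega>. (A \<omega>)\<^sup>2)"
      unfolding A2_eq using g2(1) by (intro Bochner_Integration.integrable_add Bochner_Integration.integrable_sum) auto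
    have "(\<integral>\<omega>. (A \<omega>)\<^sup>2 \<partial>M) = \<gamma> + (\<Sum>t=1..T. \<integral>\<omega>. (norm (g t \<omega>))\<^sup>2 \<partial>M)"
      unfolding A2_eq using g2(1)
      by (subst Bochner_Integration.integral_add) (auto simp: prob_space intro!: Bochner_Integration.integral_sum)
    also have "\<dots> \<le> \<gamma> + (\<Sum>t=1..T. 2 * \<sigma>\<^sup>2 + 2 * (1 + \<rho>) * n t)"
      by (intro add_left_mono sum_mono g2(2))
    also have "\<dots> = \<gamma> + 2 * \<sigma>\<^sup>2 * T + 2 * (1 + \<rho>) * m"
      by (simp add: m_def sum.distrib sum_distrib_left)
    finally have A2_le: "(\<integral>\<omega>. (A \<omega>)\<^sup>2 \<partial>M) \<le> \<gamma> + 2 * \<sigma>\<^sup>2 * T + 2 * (1 + \<rho>) * m" .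
    \<comment> \<open>Cauchy-Schwarz will separate \<open>A\<close>, whose second moment is at most
      affine in \<open>m\<close>, from \<open>W\<close>. This bounds the finite number
      \<open>m\<close> by the root of an affine function of itself.\<close>
    have "m = (\<integral>\<omega>. (\<Sum>t=1..T. inner (D t \<omega>) (g t \<omega>)) \<partial>M)"
      using Dg by (simp add: m_def)
    also have "\<dots> \<le> (\<integral>\<omega>. L * (A \<omega> * W \<omega>) \<partial>M)"
    proof (rule integral_mono)
      show "integrable M (\<lambda>\<omega>. L * (A \<omega> * W \<omega>))"
        using integrable_inner_L2[of A M W] A2 W2 by simp
      fix \<omega> assume "\<omega> \<in> space M"
      have "\<eta> * (\<Sum>t=1..T. inner (D t \<omega>) (g t \<omega>)) \<le> L * A \<omega> * (B_max xs x T \<omega> + 2 * \<eta>\<^sup>2)"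
        unfolding D_def A_def
        by (rule sda_pathwise[where x = "\<lambda>t. x t \<omega>", OF sm L min \<gamma>
              adaptive_sda_run_step[OF run \<gamma> \<open>\<omega> \<in> space M\<close>] radius \<open>T \<ge> 1\<close>])
      also have "\<dots> = \<eta> * (L * (A \<omega> * W \<omega>))"
        by (simp add: W_eq)
      finally show "(\<Sum>t=1..T. inner (D t \<omega>) (g t \<omega>)) \<le> L * (A \<omega> * W \<omega>)"
        using \<eta> by simp
    qed (use Dg in auto)
    also have "\<dots> \<le> L * (sqrt (\<integral>\<omega>. (A \<omega>)\<^sup>2 \<partial>M) * sqrt w)"
      using integral_Cauchy_Schwarz[of A M W] A2 W2 L by (simp add: w_def)
    also have "\<dots> \<le> L * (sqrt (\<gamma> + 2 * \<sigma>\<^sup>2 * T + 2 * (1 + \<rho>) * m) * sqrt w)"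
      using A2_le L by (intro mult_left_mono mult_right_mono) (auto simp: w_def)
    finally have "m \<le> L * sqrt w * sqrt (\<gamma> + 2 * \<sigma>\<^sup>2 * T + 2 * (1 + \<rho>) * m)"
      by (simp add: mult_ac)
    moreover have "m \<ge> 0" "w \<ge> 0" by (simp_all add: m_def n_def w_def sum_nonneg)
    \<comment> \<open>\<open>sqrt_self_bound\<close> with \<open>c = L * sqrt w\<close>,
      \<open>p = \<gamma>\<close>, \<open>q = 2 * \<sigma>\<^sup>2 * T\<close> and
      \<open>r = 2 * (1 + \<rho>)\<close>.\<close>
    ultimately have "m \<le> 2 * (L * sqrt w) * sqrt (2 * \<sigma>\<^sup>2 * T) + \<gamma> / 2 + (L * sqrt w)\<^sup>2 * (2 + 2 * (1 + \<rho>))"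
      using L \<gamma> \<open>\<rho> \<ge> 0\<close> by (intro sqrt_self_bound) auto
    also have "\<dots> \<le> 2 * (L * sqrt w) * sqrt (2 * \<sigma>\<^sup>2 * T) + \<gamma> / 2
        + (L * sqrt w)\<^sup>2 * (2 * sqrt 2 * (sqrt 2 + \<rho>))"
    \<comment> \<open>The constant obtained is \<open>4 + 2 * \<rho>\<close>; the stated one expands
      to \<open>4 + 2 * sqrt 2 * \<rho>\<close>.\<close>
    proof (intro add_left_mono mult_left_mono)
      have "1 * \<rho> \<le> sqrt 2 * \<rho>"
        using \<open>\<rho> \<ge> 0\<close> by (intro mult_right_mono) auto
      then show "2 + 2 * (1 + \<rho>) \<le> 2 * sqrt 2 * (sqrt 2 + \<rho>)"
        by (simp add: algebra_simps)
    qed simp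
    also have "\<dots> = 2 * sqrt 2 * L * \<sigma> * sqrt w * sqrt T + 2 * sqrt 2 * L\<^sup>2 * (sqrt 2 + \<rho>) * w + \<gamma> / 2"
      using \<open>w \<ge> 0\<close> \<open>\<sigma> \<ge> 0\<close> by (simp add: real_sqrt_mult power_mult_distrib)
    finally have m_le: "m \<le> 2 * sqrt 2 * L * \<sigma> * sqrt w * sqrt T
        + 2 * sqrt 2 * L\<^sup>2 * (sqrt 2 + \<rho>) * w + \<gamma> / 2" .
    have "(\<Sum>t=1..T. \<integral>\<^sup>+\<omega>. ennreal ((norm (D t \<omega>))\<^sup>2) \<partial>M) = (\<Sum>t=1..T. ennreal (n t))"
      using D2 by (intro sum.cong refl) (simp add: nn_integral_eq_integral n_def)
    also have "\<dots> = ennreal m"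
      by (simp add: m_def n_def sum_ennreal)
    also have "\<dots> \<le> ennreal (2 * sqrt 2 * L * \<sigma> * sqrt w * sqrt T
        + 2 * sqrt 2 * L\<^sup>2 * (sqrt 2 + \<rho>) * w + \<gamma> / 2)"
      using m_le by (rule ennreal_leI)
    also have "\<dots> = ennreal (2 * sqrt 2 * L * \<sigma>) * ennreal (sqrt w) * ennreal (sqrt T)
        + ennreal (2 * sqrt 2 * L\<^sup>2 * (sqrt 2 + \<rho>)) * ennreal w + ennreal (\<gamma> / 2)"
      using L \<gamma> \<open>\<rho> \<ge> 0\<close> \<open>\<sigma> \<ge> 0\<close> \<open>w \<ge> 0\<close> by (simp add: ennreal_mult ennreal_plus)
    also have "ennreal w = ?W2"
      using W2 by (simp add: nn_integral_eq_integral w_def)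
    also have "ennreal (sqrt w) = ennreal_sqrt ?W2"
      unfolding \<open>ennreal w = ?W2\<close>[symmetric] using \<open>w \<ge> 0\<close> by (simp add: ennreal_sqrt_def)
    finally show ?thesis .
  qed
  then show ?thesis
    unfolding D_def W_def by (rule order_trans) simp
qed

end
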